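(* Let $\alpha,\beta\in[0,1]$. For any graph $G$ on $n$ vertices, $\mathrm{Z}_{\alpha,\beta}(G)=n$ if and only if $\Delta(G)\,\alpha<\beta$.
   Context: All graphs are finite and simple with nonempty vertex set; $\Delta(G)$ is the maximum degree of $G$. Let $\alpha,\beta\in[0,1]$ (the transmission proportion and the transmission threshold), let $G$ be a graph and $B\subseteq V(G)$ a set of initially filled vertices. The transmission forcing process started from $B$ is defined as follows. Put $B_0=B$, $w_0(v)=1$ for $v\in B$ and $w_0(v)=0$ for $v\in V(G)\setminus B$. For $t\ge 1$, given the set $B_{t-1}$ of vertices filled at time $t-1$ and the weights $w_{t-1}$: for each unfilled vertex $u\in V(G)\setminus B_{t-1}$ let $\mathcal V_{t,u}$ be the set of all $v\in B_{t-1}$ such that $u$ is the only neighbor of $v$ in $V(G)\setminus B_{t-1}$ and $v\notin \mathcal V_{s,u'}$ for every $s<t$ and every $u'$ (each vertex transmits weight at most once); when $v\in\mathcal V_{t,u}$ we say $v$ forces $u$, written $v\to u$. Set $w_t(u)=w_{t-1}(u)+\sum_{v\in\mathcal V_{t,u}}\alpha\, w_{t-1}(v)$ for $u\in V(G)\setminus B_{t-1}$ and $w_t(u)=w_{t-1}(u)$ for $u\in B_{t-1}$. Then $B_t=B_{t-1}\cup\{u\in V(G)\setminus B_{t-1} : w_t(u)\ge\beta\}$. The set $B$ is an $(\alpha,\beta)$-transmission zero forcing set of $G$ if $B_t=V(G)$ for some $t\ge 0$, and the $(\alpha,\beta)$-transmission zero forcing number $\mathrm{Z}_{\alpha,\beta}(G)$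 is the minimum cardinality of such a set. *)

theory Defs
  imports Complex_Main "Graph_Theory.Pair_Digraph"
begin

text \<open>
  A finite simple graph is a \<^locale>\<open>pair_graph\<close>: a finite, loop-free digraph without parallel
  arcs whose arc relation is symmetric, the two arcs between adjacent vertices together
  representing one edge.
\<close>

definition nbrs :: "'a pair_pre_digraph \<Rightarrow> 'a \<Rightarrow> 'a set" where
  "nbrs G v = {u \<in> pverts G. (v, u) \<in> parcs G}"

definition degree :: "'a pair_pre_digraph \<Rightarrow> 'a \<Rightarrow> nat" where
  "degree G v = card (nbrs G v)"

definition max_degree :: "'a pair_pre_digraph \<Rightarrow> nat" where
  "max_degree G = Max (degree G ` pverts G)"

text \<open>
  For transmission proportion \<open>\<alpha>\<close>, threshold \<open>\<beta>\<close> and initially filled set \<open>B\<close>,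
  \<open>forcers G \<alpha> \<beta> B t u\<close> is the set of vertices forcing \<open>u\<close> at time \<open>t\<close>, \<open>weight G \<alpha> \<beta> B t\<close> and
  \<open>filled G \<alpha> \<beta> B t\<close> are the weights and the set of filled vertices after time \<open>t\<close>. Forcing
  happens from time 1 on, hence the empty set at time 0. Since \<open>forcers\<close> requires \<open>u\<close> to be the
  only unfilled neighbour, it is empty whenever \<open>u\<close> is already filled.
\<close>

function (sequential)
      forcers :: "'a pair_pre_digraph \<Rightarrow> real \<Rightarrow> real \<Rightarrow> 'a set \<Rightarrow> nat \<Rightarrow> 'a \<Rightarrow> 'a set"
  and weight :: "'a pair_pre_digraph \<Rightarrow> real \<Rightarrow> real \<Rightarrow> 'a set \<Rightarrow> nat \<Rightarrow> 'a \<Rightarrow> real"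
  and filled :: "'a pair_pre_digraph \<Rightarrow> real \<Rightarrow> real \<Rightarrow> 'a set \<Rightarrow> nat \<Rightarrow> 'a set"
where
  "forcers G \<alpha> \<beta> B 0 u = {}"
| "forcers G \<alpha> \<beta> B (Suc t) u =
     {v \<in> filled G \<alpha> \<beta> B t.
        nbrs G v \<inter> (pverts G - filled G \<alpha> \<beta> B t) = {u} \<and>
        (\<forall>s\<in>{..t}. \<forall>u'. v \<notin> forcers G \<alpha> \<beta> B s u')}"
| "weight G \<alpha> \<beta> B 0 u = (if u \<in> B then 1 else 0)"
| "weight G \<alpha> \<beta> B (Suc t) u =
     (if u \<in> pverts G - filled G \<alpha> \<beta> B t
      then weight G \<alpha> \<beta> B t u + (\<Sum>v\<in>forcers G \<alpha> \<beta> B (Suc t) u. \<alpha> * weight G \<alpha> \<beta> B t v)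
      else weight G \<alpha> \<beta> B t u)"
| "filled G \<alpha> \<beta> B 0 = B"
| "filled G \<alpha> \<beta> B (Suc t) =
     filled G \<alpha> \<beta> B t \<union>
     {u \<in> pverts G - filled G \<alpha> \<beta> B t. weight G \<alpha> \<beta> B (Suc t) u \<ge> \<beta>}"
  by pat_completeness auto
termination
  by (relation "Wellfounded.measure (case_sum (\<lambda>(G, \<alpha>, \<beta>, B, t, u). 3 * t)
       (case_sum (\<lambda>(G, \<alpha>, \<beta>, B, t, u). 3 * t + 1) (\<lambda>(G, \<alpha>, \<beta>, B, t). 3 * t + 2)))") auto

definition transmission_zero_forcing_set ::
  "real \<Rightarrow> real \<Rightarrow> 'a pair_pre_digraph \<Rightarrow> 'a set \<Rightarrow> bool" where
  "transmission_zero_forcing_set \<alpha> \<beta> G B \<longleftrightarrow>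
     B \<subseteq> pverts G \<and> (\<exists>t. filled G \<alpha> \<beta> B t = pverts G)"

definition transmission_zero_forcing_number ::
  "real \<Rightarrow> real \<Rightarrow> 'a pair_pre_digraph \<Rightarrow> nat" where
  "transmission_zero_forcing_number \<alpha> \<beta> G =
     Min (card ` {B. transmission_zero_forcing_set \<alpha> \<beta> G B})"

end

theory Submission
  imports Defs
begin

text \<open>
  A vertex transmits at most once, so if nothing is filled at time 1, then no forcing ever happens
  again. Starting from a set \<open>B\<close>, an unfilled vertex receives weight at most \<open>deg u * \<alpha>\<close> at time 1,
  with equality when it is the only unfilled vertex. Hence a proper subset can make progress only if
  \<open>\<Delta> * \<alpha> \<ge> \<beta>\<close>, and in that case leaving out a vertex of maximum degree works.
\<close>

lemma nbrs_sym:
  assumes "pair_graph G" and "v \<in> pverts G" and "u \<in> nbrs G v"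
  shows "v \<in> nbrs G u"
proof -
  interpret pair_graph G by fact
  show ?thesis
    using assms(2,3) arcs_symmetric by (auto simp: nbrs_def)
qed

lemma finite_nbrs: "finite (pverts G) \<Longrightarrow> finite (nbrs G v)"
  by (simp add: nbrs_def)

lemma degree_le_max_degree: "finite (pverts G) \<Longrightarrow> v \<in> pverts G \<Longrightarrow> degree G v \<le> max_degree G"
  by (simp add: max_degree_def)

lemma forcers_one:
  "forcers G \<alpha> \<beta> B (Suc 0) u = {v \<in> B. nbrs G v \<inter> (pverts G - B) = {u}}"
  by simp

text \<open>At time 1 every forcer lies in \<open>B\<close> and still has weight 1, so it transmits
  exactly \<alpha>, and \<open>u\<close> itself starts from weight 0.\<close>

lemma weight_one:
  assumes "u \<in> pverts G - B"
  shows "weight G \<alpha> \<beta> B (Suc 0) u = real (card (forcers G \<alpha> \<beta> B (Suc 0) u)) * \<alpha>"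
proof -
  have "(\<Sum>v\<in>forcers G \<alpha> \<beta> B (Suc 0) u. \<alpha> * (if v \<in> B then 1 else 0))
      = (\<Sum>v\<in>forcers G \<alpha> \<beta> B (Suc 0) u. \<alpha>)"
    by (rule sum.cong) auto
  then show ?thesis
    unfolding weight.simps(2) filled.simps(1) weight.simps(1)
    using assms by (simp del: forcers.simps)
qed

text \<open>Apart from the transmit-once rule, being a forcer depends only on the filled set. While
  that set is still \<open>B\<close>, any candidate already forced at time 1 and is spent, so the
  weights freeze and the threshold test keeps its outcome.\<close>

lemma filled_stationary:
  assumes "filled G \<alpha> \<beta> B (Suc 0) = B"
  shows "filled G \<alpha> \<beta> B t = B"
proof -
  \<comment> \<open>The reference point is time 1, not time 0: weights below the threshold may
    arrive at time 1 without filling anything. They are carried through the induction because they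
    decide the next filled set.\<close>
  have "filled G \<alpha> \<beta> B (Suc t) = B \<and>
    (\<forall>u. weight G \<alpha> \<beta> B (Suc t) u = weight G \<alpha> \<beta> B (Suc 0) u)" for t
  proof (induction t)
    case 0
    show ?case using assms by blast
  next
    case (Suc t)
    have fil: "filled G \<alpha> \<beta> B (Suc t) = B"
      and wt: "weight G \<alpha> \<beta> B (Suc t) u = weight G \<alpha> \<beta> B (Suc 0) u" for u
      using Suc.IH by blast+
    have "forcers G \<alpha> \<beta> B (Suc (Suc t)) u = {}" for u
    proof -
      have "v \<notin> forcers G \<alpha> \<beta> B (Suc (Suc t)) u" for v
      proof
        assume "v \<in> forcers G \<alpha> \<beta> B (Suc (Suc t)) u"
        then have "v \<in> B" "nbrs G v \<inter> (pverts G - B) = {u}"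
          and once: "\<forall>s\<in>{..Suc t}. \<forall>u'. v \<notin> forcers G \<alpha> \<beta> B s u'"
          unfolding forcers.simps(2)[of G \<alpha> \<beta> B "Suc t"] fil by blast+
        then have "v \<in> forcers G \<alpha> \<beta> B (Suc 0) u"
          unfolding forcers_one by blast
        moreover have "Suc 0 \<in> {..Suc t}" by simp
        ultimately show False using once by blast
      qed
      then show ?thesis by blast
    qed
    then have wt': "weight G \<alpha> \<beta> B (Suc (Suc t)) u = weight G \<alpha> \<beta> B (Suc 0) u" for u
      unfolding weight.simps(2)[of G \<alpha> \<beta> B "Suc t"] wt
      by (simp del: forcers.simps weight.simps filled.simps)
    \<comment> \<open>Both sides apply the same threshold test to the same filled set
      \<open>B\<close> and the same weights.\<close>
    have "filled G \<alpha> \<beta> B (Suc (Suc t)) = filled G \<alpha> \<beta> B (Suc 0)"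
      unfolding filled.simps(2)[of G \<alpha> \<beta> B "Suc t"] filled.simps(2)[of G \<alpha> \<beta> B 0]
        fil filled.simps(1) wt' ..
    with assms wt' show ?case by metis
  qed
  then show ?thesis
    by (cases t) (simp_all del: filled.simps(2))
qed

lemma filled_eq_initial:
  assumes "pair_graph G" and "B \<subseteq> pverts G" and "0 \<le> \<alpha>"
    and small: "real (max_degree G) * \<alpha> < \<beta>"
  shows "filled G \<alpha> \<beta> B t = B"
proof (rule filled_stationary)
  interpret pair_graph G by fact
  have "weight G \<alpha> \<beta> B (Suc 0) u < \<beta>" if u: "u \<in> pverts G - B" for u
  proof -
    \<comment> \<open>A forcer has \<open>u\<close> as a neighbor, so by symmetry it is counted in
      the degree of \<open>u\<close>.\<close>
    have "forcers G \<alpha> \<beta> B (Suc 0) u \<subseteq> nbrs G u"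
      unfolding forcers_one using assms(1,2) by (blast intro: nbrs_sym)
    then have "card (forcers G \<alpha> \<beta> B (Suc 0) u) \<le> degree G u"
      unfolding degree_def by (intro card_mono finite_nbrs) auto
    also have "\<dots> \<le> max_degree G"
      using u by (intro degree_le_max_degree) auto
    finally have "real (card (forcers G \<alpha> \<beta> B (Suc 0) u)) * \<alpha> \<le> real (max_degree G) * \<alpha>"
      using \<open>0 \<le> \<alpha>\<close> by (intro mult_right_mono) auto
    with small show ?thesis unfolding weight_one[OF u] by linarith
  qed
  then show "filled G \<alpha> \<beta> B (Suc 0) = B"
    unfolding filled.simps by force
qed

text \<open>With \<open>v\<close> the only unfilled vertex, all its neighbors force it at once, so
  time 1 already completes the process.\<close>

lemma transmission_zero_forcing_set_remove:
  assumes "pair_graph G" and v: "v \<in> pverts G" and large: "\<beta> \<le> real (degree G v) * \<alpha>"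
  shows "transmission_zero_forcing_set \<alpha> \<beta> G (pverts G - {v})"
proof -
  interpret pair_graph G by fact
  let ?B = "pverts G - {v}"
  have unfilled: "pverts G - ?B = {v}" using v by blast
  \<comment> \<open>Forcers must be filled; looplessness puts every neighbor of \<open>v\<close>
    into \<open>?B\<close>.\<close>
  have "v \<notin> nbrs G v"
    using no_loops by (fastforce simp: nbrs_def)
  moreover have "nbrs G v \<subseteq> pverts G" by (auto simp: nbrs_def)
  moreover have "u \<in> nbrs G v \<longleftrightarrow> v \<in> nbrs G u" if "u \<in> pverts G" for u
    using nbrs_sym[OF assms(1)] v that by blast
  ultimately have "forcers G \<alpha> \<beta> ?B (Suc 0) v = nbrs G v"
    unfolding forcers_one unfilled by blast
  then have "weight G \<alpha> \<beta> ?B (Suc 0) v = real (degree G v) * \<alpha>"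
    using weight_one[of v G ?B] v by (simp add: degree_def del: forcers.simps weight.simps)
  then have "filled G \<alpha> \<beta> ?B (Suc 0) = pverts G"
    unfolding filled.simps unfilled using large v by (auto simp del: weight.simps)
  then show ?thesis
    unfolding transmission_zero_forcing_set_def by blast
qed

theorem theorem3p2p2:
  fixes \<alpha> \<beta> :: real and G :: "'a pair_pre_digraph" and n :: nat
  assumes "\<alpha> \<in> {0..1}" and "\<beta> \<in> {0..1}"
    and "pair_graph G" and "pverts G \<noteq> {}"
    and "card (pverts G) = n"
  shows "transmission_zero_forcing_number \<alpha> \<beta> G = n \<longleftrightarrow> real (max_degree G) * \<alpha> < \<beta>"
proof -
  interpret pair_graph G by fact
  let ?S = "{B. transmission_zero_forcing_set \<alpha> \<beta> G B}"
  have "finite ?S"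
    by (rule finite_subset[of _ "Pow (pverts G)"]) (auto simp: transmission_zero_forcing_set_def)
  have all: "pverts G \<in> ?S"
    by (auto simp: transmission_zero_forcing_set_def intro: exI[of _ 0])
  show ?thesis
  proof
    assume small: "real (max_degree G) * \<alpha> < \<beta>"
    \<comment> \<open>The filled set never leaves \<open>B\<close>, so it can reach the whole vertex
      set only by starting there.\<close>
    have "B = pverts G" if "B \<in> ?S" for B
      using that filled_eq_initial[OF assms(3) _ _ small] assms(1)
      by (auto simp: transmission_zero_forcing_set_def)
    with all have "?S = {pverts G}" by blast
    then show "transmission_zero_forcing_number \<alpha> \<beta> G = n"
      using assms(5) by (simp add: transmission_zero_forcing_number_def)
  next
    assume number: "transmission_zero_forcing_number \<alpha> \<beta> G = n"
    show "real (max_degree G) * \<alpha> < \<beta>"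
    proof (rule ccontr)
      assume "\<not> real (max_degree G) * \<alpha> < \<beta>"
      \<comment> \<open>Nonemptiness of the vertex set ensures that the maximum is attained, which
        supplies the vertex to leave out.\<close>
      moreover have "max_degree G \<in> degree G ` pverts G"
        unfolding max_degree_def using assms(4) by (intro Max_in) auto
      ultimately obtain v where v: "v \<in> pverts G" and "\<beta> \<le> real (degree G v) * \<alpha>"
        by auto
      then have "pverts G - {v} \<in> ?S"
        using transmission_zero_forcing_set_remove[OF assms(3)] by blast
      then have "transmission_zero_forcing_number \<alpha> \<beta> G \<le> card (pverts G - {v})"
        unfolding transmission_zero_forcing_number_def using \<open>finite ?S\<close> by (intro Min_le) auto
      also have "\<dots> < card (pverts G)"
        using v by (intro card_Diff1_less) auto
      finally show False using number assms(5) by simp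
    qed
  qed
qed

end
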